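(* Let $X$ be a locally separable non-separable metrizable space. Then $$\dim C_s(X)=d(X)^{\aleph_0},$$ where $\dim$ denotes the dimension as a vector space over the field of scalars (the cardinality of a Hamel basis).
   Context: The field of scalars $\mathbb{F}$ is fixed and is either $\mathbb{R}$ or $\mathbb{C}$ (the result is asserted for each choice). For a space $X$, $C_b(X)$ is the set of all continuous bounded functions $X\to\mathbb{F}$. For $f\in C_b(X)$, $\mathrm{Coz}(f)=\{x\in X: f(x)\neq 0\}$ and $\mathrm{supp}(f)=\mathrm{cl}_X\,\mathrm{Coz}(f)$. For a metrizable space $X$, $C_s(X)=\{f\in C_b(X):\mathrm{supp}(f)\text{ is separable}\}$, which is an algebra over $\mathbb{F}$ under pointwise operations. The density $d(X)$ of a space $X$ is the smallest cardinal number of the form $|D|$, where $D$ is dense in $X$. A space is locally separable if each of its points has a separable open neighborhood. *)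

theory Defs
  imports "HOL-Analysis.Analysis" "HOL-Library.Function_Algebras"
begin

unbundle cardinal_syntax

definition dense_in :: "'a topology \<Rightarrow> 'a set \<Rightarrow> bool" where
  "dense_in X D \<longleftrightarrow> D \<subseteq> topspace X \<and> X closure_of D = topspace X"

lemma separable_space_iff_dense_in:
  "separable_space X \<longleftrightarrow> (\<exists>D. countable D \<and> dense_in X D)"
  by (auto simp: separable_space_def dense_in_def)

definition locally_separable_space :: "'a topology \<Rightarrow> bool" where
  "locally_separable_space X \<longleftrightarrow>
     (\<forall>x\<in>topspace X. \<exists>U. openin X U \<and> x \<in> U \<and> separable_space (subtopology X U))"

text \<open>
  A cardinal number is represented, as usual in HOL, by a cardinal order (a minimal well-order
  \<open>|A|\<close> on some set \<open>A\<close>), and equality of cardinals by \<open>=o\<close>.  The choice of the minimiser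
  below is immaterial up to \<open>=o\<close>; a minimiser exists by \<open>top_density_attained\<close>.
\<close>
definition top_density :: "'a topology \<Rightarrow> 'a rel" where
  "top_density X = |SOME D. dense_in X D \<and> (\<forall>D'. dense_in X D' \<longrightarrow> |D| \<le>o |D'| )|"

lemma top_density_attained:
  "\<exists>D. dense_in X D \<and> (\<forall>D'. dense_in X D' \<longrightarrow> |D| \<le>o |D'| ) \<and> top_density X = |D|"
proof -
  have "dense_in X (topspace X)"
    by (simp add: dense_in_def closure_of_topspace)
  then have "card_of ` {D. dense_in X D} \<noteq> {}"
    by blast
  moreover have "\<forall>r \<in> card_of ` {D. dense_in X D}. Card_order r"
    by (auto simp: card_of_Card_order)
  ultimately have "\<exists>D. dense_in X D \<and> (\<forall>D'. dense_in X D' \<longrightarrow> |D| \<le>o |D'| )"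
    using exists_minim_Card_order[of "card_of ` {D. dense_in X D}"] by auto
  from someI_ex[OF this] show ?thesis
    unfolding top_density_def by blast
qed

text \<open>
  The library's \<open>dim\<close> is a natural number (and 0 in the infinite-dimensional case), so the
  cardinality of a Hamel basis of a subspace \<open>V\<close> is introduced here.  The scalar multiplication
  is an explicit argument, as in the locale \<open>vector_space\<close>.  The choice of the basis is
  immaterial up to \<open>=o\<close>: see \<open>hamel_basis_exists\<close> and \<open>hamel_dim_eq\<close>.
\<close>
definition hamel_basis :: "('k::field \<Rightarrow> 'v::ab_group_add \<Rightarrow> 'v) \<Rightarrow> 'v set \<Rightarrow> 'v set \<Rightarrow> bool" where
  "hamel_basis sm V B \<longleftrightarrow> \<not> module.dependent sm B \<and> module.span sm B = V"

definition hamel_dim :: "('k::field \<Rightarrow> 'v::ab_group_add \<Rightarrow> 'v) \<Rightarrow> 'v set \<Rightarrow> 'v rel" where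
  "hamel_dim sm V = |SOME B. hamel_basis sm V B|"

context vector_space
begin

lemma hamel_basis_exists:
  assumes "subspace V"
  shows "\<exists>B. hamel_basis scale V B"
proof -
  obtain B where "B \<subseteq> V" "independent B" "V \<subseteq> span B"
    using maximal_independent_subset[of V] by blast
  moreover from this have "span B \<subseteq> V"
    by (simp add: assms span_minimal)
  ultimately show ?thesis
    unfolding hamel_basis_def by blast
qed

lemma hamel_basis_ordLeq:
  assumes B: "hamel_basis scale V B" and B': "hamel_basis scale V B'"
  shows "|B'| \<le>o |B|"
proof (cases "finite B")
  case True
  have "B' \<subseteq> span B"
    using B B' span_superset[of B'] by (auto simp: hamel_basis_def)
  with True B' have "finite B' \<and> card B' \<le> card B"
    using independent_span_bound unfolding hamel_basis_def by blast
  with True have "\<exists>f. inj_on f B' \<and> f ` B' \<subseteq> B"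
    using inj_on_iff_card_le[of B' B] by blast
  then show ?thesis
    using card_of_ordLeq[of B' B] by blast
next
  case False
  have "\<exists>S. finite S \<and> S \<subseteq> B' \<and> b \<in> span S" if "b \<in> B" for b
  proof -
    have "b \<in> span B'"
      using that B B' span_base[of b B] by (simp add: hamel_basis_def)
    then obtain S r where "finite S" "S \<subseteq> B'" "b = (\<Sum>a\<in>S. r a *s a)"
      unfolding span_explicit by blast
    moreover from this have "b \<in> span S"
      by (auto intro: span_sum span_scale span_base)
    ultimately show ?thesis
      by blast
  qed
  then obtain S where S: "\<And>b. b \<in> B \<Longrightarrow> finite (S b) \<and> S b \<subseteq> B' \<and> b \<in> span (S b)"
    by metis
  let ?T = "\<Union>b\<in>B. S b"
  have TB': "?T \<subseteq> B'"
    using S by blast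
  have "B \<subseteq> span ?T"
  proof
    fix b assume "b \<in> B"
    then have "b \<in> span (S b)" "S b \<subseteq> ?T"
      using S by auto
    then show "b \<in> span ?T"
      using span_mono by blast
  qed
  then have "span B \<subseteq> span ?T"
    by (simp add: span_minimal)
  then have *: "B' \<subseteq> span ?T"
    using B B' span_superset[of B'] by (auto simp: hamel_basis_def)
  have "B' \<subseteq> ?T"
  proof
    fix x assume x: "x \<in> B'"
    show "x \<in> ?T"
    proof (rule ccontr)
      assume "x \<notin> ?T"
      then have "?T \<subseteq> B' - {x}"
        using TB' by blast
      then have "x \<in> span (B' - {x})"
        using * x span_mono by blast
      then show False
        using B' x unfolding hamel_basis_def dependent_def by blast
    qed
  qed
  moreover have "|?T| \<le>o |B|"
  proof (rule card_of_UNION_ordLeq_infinite[OF False])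
    show "|B| \<le>o |B|"
      by (rule card_of_mono1) simp
    show "\<forall>b\<in>B. |S b| \<le>o |B|"
    proof
      fix b assume "b \<in> B"
      then have "\<not> |B| \<le>o |S b|"
        using S False card_of_ordLeq_finite by blast
      then show "|S b| \<le>o |B|"
        using ordLeq_total[OF card_of_Well_order[of "S b"] card_of_Well_order[of B]] by blast
    qed
  qed
  ultimately show ?thesis
    by (meson card_of_mono1 ordLeq_transitive)
qed

lemma hamel_dim_eq:
  assumes "hamel_basis scale V B"
  shows "hamel_dim scale V =o |B|"
proof -
  have "hamel_basis scale V (SOME B. hamel_basis scale V B)"
    using assms by (rule someI)
  then show ?thesis
    unfolding hamel_dim_def using assms hamel_basis_ordLeq by (simp add: ordIso_iff_ordLeq)
qed

end

text \<open>
  A function \<open>X \<rightarrow> F\<close> on the carrier \<open>topspace X\<close> is represented by the function on the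
  ambient type extending it by \<open>0\<close>; this representation is unique and respects the pointwise
  operations, for which the function type is already an instance of the additive classes.
\<close>
definition Cb :: "'a topology \<Rightarrow> ('a \<Rightarrow> 'k::real_normed_field) set" where
  "Cb X = {f. continuous_map X euclidean f \<and> bounded (f ` topspace X) \<and>
              (\<forall>x. x \<notin> topspace X \<longrightarrow> f x = 0)}"

definition Coz :: "'a topology \<Rightarrow> ('a \<Rightarrow> 'k::zero) \<Rightarrow> 'a set" where
  "Coz X f = {x \<in> topspace X. f x \<noteq> 0}"

definition supp :: "'a topology \<Rightarrow> ('a \<Rightarrow> 'k::zero) \<Rightarrow> 'a set" where
  "supp X f = X closure_of Coz X f"

definition Cs :: "'a topology \<Rightarrow> ('a \<Rightarrow> 'k::real_normed_field) set" where
  "Cs X = {f \<in> Cb X. separable_space (subtopology X (supp X f))}"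

definition fun_scale :: "'k::times \<Rightarrow> ('a \<Rightarrow> 'k) \<Rightarrow> 'a \<Rightarrow> 'k" where
  "fun_scale c f = (\<lambda>x. c * f x)"

global_interpretation fun_scale: vector_space "fun_scale :: 'k::field \<Rightarrow> ('a \<Rightarrow> 'k) \<Rightarrow> 'a \<Rightarrow> 'k"
  by unfold_locales (auto simp: fun_scale_def fun_eq_iff algebra_simps)

lemma separable_subtopology_iff:
  assumes "S \<subseteq> topspace X"
  shows "separable_space (subtopology X S) \<longleftrightarrow>
         (\<exists>C. countable C \<and> C \<subseteq> S \<and> S \<subseteq> X closure_of C)"
proof -
  have "topspace (subtopology X S) = S"
    using assms by auto
  moreover have "subtopology X S closure_of C = S \<inter> X closure_of C" if "C \<subseteq> S" for C
    using that by (simp add: closure_of_subtopology Int_absorb1)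
  ultimately show ?thesis
    unfolding separable_space_def by (metis inf.absorb_iff1)
qed

lemma subspace_Cs: "fun_scale.subspace (Cs X :: ('a \<Rightarrow> 'k::real_normed_field) set)"
proof -
  have open_Coz: "openin X (Coz X f)" if "f \<in> Cb X" for f :: "'a \<Rightarrow> 'k"
  proof -
    have "openin X {x \<in> topspace X. f x \<in> - {0}}"
      using that by (intro openin_continuous_map_preimage[of X euclidean]) (auto simp: Cb_def)
    then show ?thesis
      by (simp add: Coz_def)
  qed
  have Coz_top: "Coz X f \<subseteq> topspace X" for f :: "'a \<Rightarrow> 'k"
    by (auto simp: Coz_def)
  have supp_top: "supp X f \<subseteq> topspace X" for f :: "'a \<Rightarrow> 'k"
    by (simp add: supp_def closure_of_subset_topspace)
  have *: "f \<in> Cs X" if f: "f \<in> Cb X" and sub: "Coz X f \<subseteq> supp X g \<union> supp X h"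
    and gh: "g \<in> Cs X" "h \<in> Cs X" for f g h :: "'a \<Rightarrow> 'k"
  proof -
    let ?S = "supp X g \<union> supp X h"
    obtain C D where C: "countable C" "C \<subseteq> supp X g" "supp X g \<subseteq> X closure_of C"
      and D: "countable D" "D \<subseteq> supp X h" "supp X h \<subseteq> X closure_of D"
      using gh by (auto simp: Cs_def separable_subtopology_iff supp_top)
    have "countable (C \<union> D)" "C \<union> D \<subseteq> ?S" "?S \<subseteq> X closure_of (C \<union> D)"
      using C D by (auto simp: closure_of_Un)
    then have "separable_space (subtopology X ?S)"
      using supp_top[of g] supp_top[of h] by (subst separable_subtopology_iff) blast+
    moreover have "openin (subtopology X ?S) (Coz X f)"
      using open_Coz[OF f] sub by (metis openin_subtopology inf.absorb_iff1)
    ultimately have "separable_space (subtopology (subtopology X ?S) (Coz X f))"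
      by (rule separable_space_open_subset)
    then have "separable_space (subtopology X (Coz X f))"
      using sub by (simp add: subtopology_subtopology Int_absorb1)
    then obtain E where E: "countable E" "E \<subseteq> Coz X f" "Coz X f \<subseteq> X closure_of E"
      by (auto simp: separable_subtopology_iff Coz_top)
    have "Coz X f \<subseteq> supp X f"
      unfolding supp_def by (simp add: closure_of_subset Coz_top)
    then have "E \<subseteq> supp X f"
      using E by blast
    moreover have "supp X f \<subseteq> X closure_of E"
      unfolding supp_def using E by (simp add: closure_of_minimal)
    ultimately have "separable_space (subtopology X (supp X f))"
      using E(1) separable_subtopology_iff[OF supp_top] by blast
    with f show ?thesis
      by (simp add: Cs_def)
  qed
  have Coz_supp: "x \<in> supp X f" if "x \<in> topspace X" "f x \<noteq> 0" for x and f :: "'a \<Rightarrow> 'k"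
    using closure_of_subset[OF Coz_top, of f] that unfolding supp_def by (auto simp: Coz_def)
  have zero: "(0 :: 'a \<Rightarrow> 'k) \<in> Cs X"
  proof -
    have "supp X (0 :: 'a \<Rightarrow> 'k) = {}"
      by (simp add: supp_def Coz_def)
    moreover have "separable_space (trivial_topology :: 'a topology)"
      by (auto simp: separable_space_def)
    moreover have "bounded ((\<lambda>x. 0 :: 'k) ` topspace X)"
      by (rule bounded_subset[of "{0}"]) auto
    ultimately show ?thesis
      by (simp add: Cs_def Cb_def zero_fun_def)
  qed
  have add: "f + g \<in> Cs X" if "f \<in> Cs X" "g \<in> Cs X" for f g :: "'a \<Rightarrow> 'k"
  proof (rule *[OF _ _ that])
    show "f + g \<in> Cb X"
      using that by (auto simp: Cs_def Cb_def plus_fun_def bounded_plus_comp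
          intro!: continuous_map_add)
    show "Coz X (f + g) \<subseteq> supp X f \<union> supp X g"
    proof
      fix x assume "x \<in> Coz X (f + g)"
      then have "x \<in> topspace X" "f x \<noteq> 0 \<or> g x \<noteq> 0"
        by (auto simp: Coz_def)
      then show "x \<in> supp X f \<union> supp X g"
        using Coz_supp by blast
    qed
  qed
  have scale: "fun_scale c f \<in> Cs X" if f: "f \<in> Cs X" for c and f :: "'a \<Rightarrow> 'k"
  proof (rule *[OF _ _ f f])
    have "bounded ((\<lambda>y. c * y) ` (f ` topspace X))"
      using f by (intro bounded_linear_image bounded_linear_mult_right) (auto simp: Cs_def Cb_def)
    then have "bounded ((\<lambda>x. c * f x) ` topspace X)"
      by (simp add: image_image)
    moreover have "continuous_map X euclidean (\<lambda>x. c * f x)"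
    proof -
      have "continuous_map euclidean euclidean (\<lambda>y. c * y)"
        by (auto intro: continuous_intros)
      then have "continuous_map X euclidean ((\<lambda>y. c * y) \<circ> f)"
        using f by (auto simp: Cs_def Cb_def intro: continuous_map_compose)
      then show ?thesis
        by (simp add: o_def)
    qed
    ultimately show "fun_scale c f \<in> Cb X"
      using f by (auto simp: Cs_def Cb_def fun_scale_def)
    show "Coz X (fun_scale c f) \<subseteq> supp X f \<union> supp X f"
      using Coz_supp by (auto simp: Coz_def fun_scale_def)
  qed
  show ?thesis
    by (intro fun_scale.subspaceI zero add scale)
qed

end

theory Submission
  imports Defs
begin

text \<open>
  Write \<open>d\<close> for the density of \<open>X\<close> and \<open>D\<close> for a dense set of size \<open>d\<close>.

  The upper bound counts functions instead of basis vectors.  The support of \<open>f \<in> Cs X\<close> lies in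
  the closure of a countable subset of \<open>D\<close>, because it has a countable dense subset
  and a point of a metrizable space in the closure of \<open>D\<close> is already a limit of a sequence from \<open>D\<close>.  So \<open>f\<close> is determined by a sequence in \<open>D\<close>
  together with the sequence of its values there.  There are \<open>d\<^sup>\<omega>\<close> sequences of points, and the
  at most \<open>2\<^sup>\<omega>\<close> sequences of scalars add nothing (\<open>card_of_Cs_ordLeq\<close>).

  For the lower bound, take a maximal family \<open>\<U>\<close> of pairwise disjoint nonempty separable open
  sets.  Local separability makes its union dense, so choosing a countable dense subset in each
  member gives \<open>d \<le> |\<U>| \<cdot> \<omega> = |\<U>|\<close>; here \<open>\<U>\<close> is infinite because \<open>X\<close> is not
  separable.  It remains to find \<open>|\<U>|\<^sup>\<omega>\<close> linearly independent functions
  (\<open>independent_family_in_Cs\<close>).  Finite sequences in \<open>\<U>\<close> can be coded injectively by members of \<open>\<U>\<close>,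
  so each infinite sequence \<open>s\<close> in \<open>\<U>\<close> selects the infinite set of the codes of its finite
  prefixes, that is, a branch of the tree of finite sequences.  Distinct branches share only
  finitely many nodes.  Let \<open>F s\<close> be the sum of bump functions supported on the members of its
  branch, with weights \<open>2\<^sup>-\<^sup>n\<close>, which make the sum uniformly convergent and hence continuous.  Given
  finitely many further sequences, a long enough prefix of \<open>s\<close> is a node on none of their branches,
  so at the peak of the bump at that node \<open>F s\<close> is the only one of these functions that does not
  vanish.  This gives linear independence whatever the size of \<open>d\<^sup>\<omega>\<close> compared with the field.
\<close>

section \<open>Cardinal arithmetic\<close>

text \<open>
  Folding a list with an injection \<open>A \<times> A \<rightarrow> A\<close> is injective on lists of equal length; pairing the
  result with a tag for the length makes the coding injective on all lists.
\<close>
lemma list_code_exists: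
  assumes "infinite A"
  shows "\<exists>c. inj_on c (lists A) \<and> c ` lists A \<subseteq> A"
proof -
  have "|A \<times> A| \<le>o |A|"
    using card_of_Times_same_infinite[OF assms] ordIso_iff_ordLeq by blast
  then obtain p where p: "inj_on p (A \<times> A)" "p ` (A \<times> A) \<subseteq> A"
    unfolding card_of_ordLeq[symmetric] by blast
  obtain t :: "nat \<Rightarrow> 'a" where t: "inj t" "range t \<subseteq> A"
    using infinite_countable_subset[OF assms] by blast
  define e where "e xs = foldr (\<lambda>x y. p (x, y)) xs (t 0)" for xs
  have e: "e xs \<in> A" if "xs \<in> lists A" for xs
    using that by (induction xs) (use p(2) t(2) in \<open>auto simp: e_def\<close>)
  have e_inj: "xs = ys" if "length xs = length ys" "xs \<in> lists A" "ys \<in> lists A" "e xs = e ys"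
    for xs ys
    using that
  proof (induction xs ys rule: list_induct2)
    case (Cons x xs y ys)
    have "p (x, e xs) = p (y, e ys)"
      using Cons.prems by (simp add: e_def)
    moreover have "(x, e xs) \<in> A \<times> A" "(y, e ys) \<in> A \<times> A"
      using Cons.prems e by auto
    ultimately have "x = y \<and> e xs = e ys"
      using p(1) unfolding inj_on_def by blast
    with Cons show ?case by auto
  qed simp
  define c where "c xs = p (t (length xs), e xs)" for xs
  have "inj_on c (lists A)"
  proof (rule inj_onI)
    fix xs ys assume xy: "xs \<in> lists A" "ys \<in> lists A" "c xs = c ys"
    moreover have "(t (length xs), e xs) \<in> A \<times> A" "(t (length ys), e ys) \<in> A \<times> A"
      using xy e t(2) by auto
    ultimately have "t (length xs) = t (length ys)" "e xs = e ys"
      using p(1) unfolding c_def inj_on_def by blast+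
    then show "xs = ys"
      using xy e_inj t(1) by (auto dest: injD)
  qed
  moreover have "c ` lists A \<subseteq> A"
  proof -
    have "(t (length xs), e xs) \<in> A \<times> A" if "xs \<in> lists A" for xs
      using that e t(2) by auto
    then show ?thesis
      using p(2) unfolding c_def by blast
  qed
  ultimately show ?thesis by blast
qed

text \<open>
  On the index set \<open>UNIV\<close> the functions in \<open>Func\<close> carry no \<open>undefined\<close> values, so they are plain
  sequences.
\<close>
lemma card_of_cexp_natLeq: "|A| ^c natLeq = |{s :: nat \<Rightarrow> 'a. range s \<subseteq> A}|"
proof -
  have "Func (UNIV :: nat set) A = {s. range s \<subseteq> A}"
    by (auto simp: Func_def)
  then show ?thesis
    by (simp add: cexp_def Field_natLeq Field_card_of)
qed

lemma nat_set_ordLeq_cexp_natLeq: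
  assumes "infinite A"
  shows "|UNIV :: nat set set| \<le>o |A| ^c natLeq"
proof -
  obtain a b where ab: "a \<in> A" "b \<in> A" "a \<noteq> b"
  proof -
    obtain a where "a \<in> A"
      using assms by (metis ex_in_conv finite.emptyI)
    moreover obtain b where "b \<in> A - {a}"
      using assms infinite_remove by (metis ex_in_conv finite.emptyI)
    ultimately show thesis
      using that by blast
  qed
  let ?h = "\<lambda>(S :: nat set) n. if n \<in> S then a else b"
  have "inj ?h"
  proof (rule injI)
    fix S T :: "nat set" assume "?h S = ?h T"
    then have "n \<in> S \<longleftrightarrow> n \<in> T" for n
      using ab(3) by (metis (mono_tags))
    then show "S = T" by blast
  qed
  then show ?thesis
    unfolding card_of_cexp_natLeq using ab by (intro card_of_ordLeqI[of ?h]) auto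
qed

text \<open>
  By the \<open>T\<^sub>0\<close> axiom a point is determined by the members of a countable basis that contain it, so
  a sequence is determined by a set of pairs of natural numbers.  This bounds the number of sequences
  of real and of complex scalars at once.
\<close>
lemma sequences_ordLeq_nat_set:
  "|UNIV :: (nat \<Rightarrow> 'k::{second_countable_topology, t0_space}) set| \<le>o |UNIV :: nat set set|"
proof -
  obtain \<B> :: "'k set set" where \<B>: "countable \<B>" "topological_basis \<B>"
    using ex_countable_basis by blast
  let ?h = "\<lambda>t :: nat \<Rightarrow> 'k. {prod_encode (m, to_nat_on \<B> U) |m U. U \<in> \<B> \<and> t m \<in> U}"
  have "inj ?h"
  proof (rule injI, rule ccontr)
    fix s t :: "nat \<Rightarrow> 'k" assume eq: "?h s = ?h t" and "s \<noteq> t"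
    have mem: "prod_encode (m, to_nat_on \<B> U) \<in> ?h u \<longleftrightarrow> u m \<in> U" if "U \<in> \<B>" for u m U
      using that \<B>(1) by auto
    have same: "s m \<in> U \<longleftrightarrow> t m \<in> U" if "U \<in> \<B>" for m U
      using mem[OF that, of m s] mem[OF that, of m t] eq by simp
    obtain m where "s m \<noteq> t m"
      using \<open>s \<noteq> t\<close> by blast
    then obtain V where V: "open V" "\<not> (s m \<in> V \<longleftrightarrow> t m \<in> V)"
      using separation_t0[of "s m" "t m"] by blast
    have "\<exists>U\<in>\<B>. y \<in> U \<and> U \<subseteq> V" if "y \<in> V" for y
      by (rule topological_basisE[OF \<B>(2) V(1) that]) blast
    then have "s m \<in> V \<longleftrightarrow> t m \<in> V"
      using same[of _ m] by (meson subsetD)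
    with V(2) show False ..
  qed
  then show ?thesis
    by (intro card_of_ordLeqI[of ?h]) auto
qed

section \<open>Linear independence and Hamel dimension\<close>

lemma (in vector_space) independent_ordLeq_hamel_dim:
  assumes "subspace V" "B \<subseteq> V" "independent B"
  shows "|B| \<le>o hamel_dim scale V"
proof -
  obtain B' where B': "B \<subseteq> B'" "B' \<subseteq> V" "independent B'" "V \<subseteq> span B'"
    using maximal_independent_subset_extend[OF assms(2,3)] .
  have "span B' = V"
    using B' assms(1) by (simp add: span_minimal subset_antisym)
  then have "hamel_dim scale V =o |B'|"
    using B'(3) by (intro hamel_dim_eq) (simp add: hamel_basis_def)
  moreover have "|B| \<le>o |B'|"
    by (simp add: B'(1) card_of_mono1)
  ultimately show ?thesis
    using ordIso_symmetric ordLeq_ordIso_trans by blast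
qed

lemma (in vector_space) hamel_dim_ordLeq:
  assumes "subspace V"
  shows "hamel_dim scale V \<le>o |V|"
proof -
  obtain B where B: "hamel_basis scale V B"
    using hamel_basis_exists[OF assms] by blast
  then have "B \<subseteq> V"
    using span_superset[of B] by (simp add: hamel_basis_def)
  then show ?thesis
    using hamel_dim_eq[OF B] card_of_mono1 ordIso_ordLeq_trans by blast
qed

text \<open>
  If each function of a finite subfamily is singled out by a point at which all the others vanish,
  evaluation at that point isolates its coefficient in a vanishing linear combination.
\<close>
lemma independent_if_separating_points:
  fixes F :: "'s \<Rightarrow> 'a \<Rightarrow> 'k::field"
  assumes sep: "\<And>T s. \<lbrakk>finite T; T \<subseteq> A; s \<in> A - T\<rbrakk> \<Longrightarrow> \<exists>x. F s x \<noteq> 0 \<and> (\<forall>t\<in>T. F t x = 0)"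
  shows "inj_on F A" "\<not> fun_scale.dependent (F ` A)"
proof -
  show inj: "inj_on F A"
  proof (rule inj_onI, rule ccontr)
    fix s t assume "s \<in> A" "t \<in> A" "F s = F t" "s \<noteq> t"
    then show False
      using sep[of "{t}" s] by auto
  qed
  show "\<not> fun_scale.dependent (F ` A)"
    unfolding fun_scale.independent_explicit_module
  proof (intro allI impI)
    fix S u v
    assume S: "finite S" "S \<subseteq> F ` A" and zero: "(\<Sum>w\<in>S. fun_scale (u w) w) = 0" and v: "v \<in> S"
    obtain T where T: "T \<subseteq> A" "finite T" "S = F ` T"
      using S finite_subset_image by blast
    then obtain s where s: "s \<in> T" "v = F s"
      using v by blast
    obtain x where x: "F s x \<noteq> 0" "\<forall>t\<in>T - {s}. F t x = 0"
      using sep[of "T - {s}" s] s T by blast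
    have "0 = (\<Sum>w\<in>S. fun_scale (u w) w) x"
      by (simp add: zero)
    also have "\<dots> = (\<Sum>w\<in>S. u w * w x)"
      using S(1) by (induction S rule: finite_induct) (auto simp: fun_scale_def)
    also have "\<dots> = u v * v x"
    proof -
      have "w x = 0" if "w \<in> S - {v}" for w
        using that T(3) s(2) x(2) by auto
      then show ?thesis
        using S(1) v by (simp add: sum.remove[of _ v] sum.neutral)
    qed
    finally show "u v = 0"
      using x(1) s(2) by simp
  qed
qed

section \<open>Functions with separable support\<close>

lemma openin_Coz:
  fixes f :: "'a \<Rightarrow> 'k::real_normed_field"
  assumes "f \<in> Cb X"
  shows "openin X (Coz X f)"
proof -
  have "openin X {x \<in> topspace X. f x \<in> - {0}}"
    using assms by (intro openin_continuous_map_preimage[of X euclidean]) (auto simp: Cb_def)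
  then show ?thesis
    by (simp add: Coz_def)
qed

text \<open>
  The countable set \<open>C\<close> may lie off the support of \<open>f\<close>, but because \<open>Coz X f\<close> is open the part of
  \<open>C\<close> inside it is still dense in it.
\<close>
lemma Cs_if_Coz_subset_closure_countable:
  fixes f :: "'a \<Rightarrow> 'k::real_normed_field"
  assumes f: "f \<in> Cb X" and C: "countable C" "Coz X f \<subseteq> X closure_of C"
  shows "f \<in> Cs X"
proof -
  have top: "Coz X f \<subseteq> topspace X"
    by (auto simp: Coz_def)
  have "Coz X f \<subseteq> X closure_of (Coz X f \<inter> C)"
    using openin_Int_closure_of_subset[OF openin_Coz[OF f], of C] C(2) by blast
  then have "supp X f \<subseteq> X closure_of (Coz X f \<inter> C)"
    unfolding supp_def by (simp add: closure_of_minimal)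
  moreover have "Coz X f \<inter> C \<subseteq> supp X f"
    using closure_of_subset[OF top] by (auto simp: supp_def)
  ultimately have "separable_space (subtopology X (supp X f))"
    using C(1) by (subst separable_subtopology_iff)
      (auto simp: supp_def closure_of_subset_topspace intro!: exI[of _ "Coz X f \<inter> C"])
  with f show ?thesis
    by (simp add: Cs_def)
qed

text \<open>
  Each of the countably many points of \<open>C\<close> is the limit of a sequence from \<open>D\<close>; the terms of all
  these sequences form \<open>E\<close>.
\<close>
lemma metrizable_closure_of_countable:
  assumes "metrizable_space X" "countable C" "C \<subseteq> X closure_of D"
  shows "\<exists>E. countable E \<and> E \<subseteq> D \<and> C \<subseteq> X closure_of E"
proof -
  obtain M d where "Metric_space M d" and X: "X = Metric_space.mtopology M d"
    using assms(1) by (auto simp: metrizable_space_def)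
  then interpret Metric_space M d by simp
  have "\<exists>\<sigma>. range \<sigma> \<subseteq> D \<inter> M \<and> limitin mtopology \<sigma> x sequentially" if "x \<in> C" for x
    using that assms(3) unfolding X closure_of_sequentially[of D] by blast
  then obtain \<sigma> :: "'a \<Rightarrow> nat \<Rightarrow> 'a"
    where \<sigma>: "\<And>x. x \<in> C \<Longrightarrow> range (\<sigma> x) \<subseteq> D \<inter> M \<and> limitin mtopology (\<sigma> x) x sequentially"
    using bchoice[of C "\<lambda>x \<sigma>. range \<sigma> \<subseteq> D \<inter> M \<and> limitin mtopology \<sigma> x sequentially"] by blast
  let ?E = "\<Union>x\<in>C. range (\<sigma> x)"
  have "x \<in> mtopology closure_of ?E" if "x \<in> C" for x
  proof -
    have "x \<in> M"
      using that assms(3) in_closure_of[of x X D] X by auto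
    then have "x \<in> mtopology closure_of range (\<sigma> x)"
      using \<sigma>[OF that] by (auto simp: closure_of_sequentially[of "range (\<sigma> x)"])
    then show ?thesis
      using closure_of_mono[of "range (\<sigma> x)" ?E mtopology] that by blast
  qed
  moreover have "countable ?E" "?E \<subseteq> D"
    using assms(2) \<sigma> by auto
  ultimately show ?thesis
    unfolding X by blast
qed

text \<open>
  The upper bound.  For each \<open>f\<close> a sequence in \<open>D\<close> is fixed whose closure contains \<open>Coz X f\<close>.  Two
  functions with the same sequence and the same values along it agree on its closure by continuity,
  and both vanish off that closure.
\<close>
lemma card_of_Cs_ordLeq:
  fixes X :: "'a topology"
  assumes X: "metrizable_space X" and D: "dense_in X D" "infinite D"
  shows "|Cs X :: ('a \<Rightarrow> 'k::{real_normed_field, second_countable_topology}) set| \<le>o |D| ^c natLeq"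
proof -
  let ?C = "Cs X :: ('a \<Rightarrow> 'k) set"
  let ?S = "{s :: nat \<Rightarrow> 'a. range s \<subseteq> D}"
  have "\<exists>s. s \<in> ?S \<and> Coz X f \<subseteq> X closure_of range s" if f: "f \<in> ?C" for f
  proof -
    have supp: "supp X f \<subseteq> topspace X" "Coz X f \<subseteq> supp X f"
      by (auto simp: supp_def closure_of_subset_topspace Coz_def intro!: closure_of_subset)
    obtain C where C: "countable C" "C \<subseteq> supp X f" "supp X f \<subseteq> X closure_of C"
      using f separable_subtopology_iff[OF supp(1)] by (auto simp: Cs_def)
    have "C \<subseteq> X closure_of D"
      using C(2) supp(1) D(1) by (auto simp: dense_in_def)
    then obtain E where E: "countable E" "E \<subseteq> D" "C \<subseteq> X closure_of E"
      using metrizable_closure_of_countable[OF X C(1)] by metis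
    \<comment> \<open>The set \<open>E\<close> may be empty if \<open>f = 0\<close>; adding a point of \<open>D\<close> lets it be the range of a sequence.\<close>
    obtain d where "d \<in> D"
      using D(2) by (metis ex_in_conv finite.emptyI)
    then have "countable (insert d E)" "insert d E \<noteq> {}"
      using E(1) by auto
    then have s: "range (from_nat_into (insert d E)) = insert d E"
      by (intro range_from_nat_into)
    have "X closure_of C \<subseteq> X closure_of (insert d E)"
      using E(3) closure_of_mono[of E "insert d E" X] by (intro closure_of_minimal) auto
    then have "Coz X f \<subseteq> X closure_of range (from_nat_into (insert d E))"
      unfolding s using C(3) supp(2) by (meson order_trans)
    moreover have "from_nat_into (insert d E) \<in> ?S"
      unfolding mem_Collect_eq s using E(2) \<open>d \<in> D\<close> by simp
    ultimately show ?thesis by blast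
  qed
  then obtain s where s: "\<And>f. f \<in> ?C \<Longrightarrow> s f \<in> ?S \<and> Coz X f \<subseteq> X closure_of range (s f)"
    by metis
  have inj: "inj_on (\<lambda>f. (s f, f \<circ> s f)) ?C"
  proof (rule inj_onI, rule ext)
    fix f g x assume f: "f \<in> ?C" and g: "g \<in> ?C" and eq: "(s f, f \<circ> s f) = (s g, g \<circ> s g)"
    show "f x = g x"
    proof (cases "x \<in> X closure_of range (s f)")
      case True
      then show ?thesis
      proof (rule forall_in_closure_of_eq)
        show "Hausdorff_space (euclidean :: 'k topology)"
          by simp
        show "continuous_map X euclidean f" "continuous_map X euclidean g"
          using f g by (auto simp: Cs_def Cb_def)
        show "f y = g y" if "y \<in> range (s f)" for y
          using that eq by (auto simp: fun_eq_iff)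
      qed
    next
      case False
      then have "x \<notin> Coz X f" "x \<notin> Coz X g"
        using s[OF f] s[OF g] eq by auto
      then show ?thesis
        using f g by (auto simp: Coz_def Cs_def Cb_def)
    qed
  qed
  have "|?C| \<le>o |?S \<times> (UNIV :: (nat \<Rightarrow> 'k) set)|"
    by (rule card_of_ordLeqI[OF inj]) (use s in auto)
  also have "|?S \<times> (UNIV :: (nat \<Rightarrow> 'k) set)| \<le>o |?S \<times> ?S|"
    using sequences_ordLeq_nat_set nat_set_ordLeq_cexp_natLeq[OF D(2)]
    unfolding card_of_cexp_natLeq by (intro card_of_Times_mono2) (rule ordLeq_transitive)
  also have "|?S \<times> ?S| =o |?S|"
  proof (rule card_of_Times_same_infinite)
    have "infinite (UNIV :: nat set set)"
      by (simp add: Finite_Set.finite_set)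
    then show "infinite ?S"
      using nat_set_ordLeq_cexp_natLeq[OF D(2)] card_of_ordLeq_infinite
      unfolding card_of_cexp_natLeq by blast
  qed
  finally show ?thesis
    unfolding card_of_cexp_natLeq .
qed

section \<open>A large linearly independent family\<close>

text \<open>
  The separating function of complete regularity, turned upside down and cut off outside \<open>U\<close>, so
  that it vanishes also outside the carrier of \<open>X\<close>, as \<open>Cb\<close> requires.
\<close>
lemma bump_function_exists:
  assumes "completely_regular_space X" "openin X U" "p \<in> U"
  shows "\<exists>g :: 'a \<Rightarrow> real. continuous_map X euclidean g \<and> (\<forall>x. 0 \<le> g x \<and> g x \<le> 1) \<and>
           g p = 1 \<and> (\<forall>x. x \<notin> U \<longrightarrow> g x = 0)"
proof -
  have U: "U \<subseteq> topspace X"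
    using assms(2) openin_subset by blast
  have "closedin X (topspace X - U)" "p \<in> topspace X - (topspace X - U)"
    using assms U by auto
  then obtain f :: "'a \<Rightarrow> real" where f: "continuous_map X (top_of_set {0..1}) f" "f p = 0"
      "f ` (topspace X - U) \<subseteq> {1}"
    using assms(1) unfolding completely_regular_space_def by meson
  define g where "g x = (if x \<in> U then 1 - f x else 0)" for x
  have f': "continuous_map X euclidean f" "\<And>x. x \<in> topspace X \<Longrightarrow> 0 \<le> f x \<and> f x \<le> 1"
    using f(1) by (auto simp: continuous_map_in_subtopology)
  have "continuous_map X euclidean g"
    by (rule continuous_map_eq[of X euclidean "\<lambda>x. 1 - f x"])
      (use f f' in \<open>auto simp: g_def intro: continuous_map_diff\<close>)
  moreover have "0 \<le> g x \<and> g x \<le> 1" for x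
    using f'(2)[of x] U by (auto simp: g_def)
  ultimately show ?thesis
    using assms(3) f(2) by (intro exI[of _ g]) (auto simp: g_def)
qed

lemma continuous_map_suminf:
  fixes f :: "nat \<Rightarrow> 'a \<Rightarrow> real"
  assumes cont: "\<And>n. continuous_map X euclidean (f n)"
    and bound: "\<And>n x. x \<in> topspace X \<Longrightarrow> norm (f n x) \<le> M n" and "summable M"
  shows "continuous_map X euclidean (\<lambda>x. \<Sum>n. f n x)"
proof -
  have lim: "uniform_limit (topspace X) (\<lambda>n x. \<Sum>i<n. f i x) (\<lambda>x. \<Sum>i. f i x) sequentially"
    using bound \<open>summable M\<close> by (rule Weierstrass_m_test)
  have "continuous_map X Met_TC.mtopology (\<lambda>x. \<Sum>n. f n x)"
  proof (rule Met_TC.continuous_map_uniform_limit[where F = sequentially])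
    show "\<forall>\<^sub>F n in sequentially. continuous_map X Met_TC.mtopology (\<lambda>x. \<Sum>i<n. f i x)"
      by (auto intro!: always_eventually continuous_map_sum cont)
  next
    fix \<epsilon> :: real assume "0 < \<epsilon>"
    then show "\<forall>\<^sub>F n in sequentially. \<forall>x\<in>topspace X.
        (\<Sum>i. f i x) \<in> UNIV \<and> dist (\<Sum>i<n. f i x) (\<Sum>i. f i x) < \<epsilon>"
      using lim by (simp add: uniform_limit_iff)
  qed simp
  then show ?thesis
    by simp
qed

text \<open>
  If the union missed a neighbourhood of some point, then a separable open piece of that
  neighbourhood could be added to the family.
\<close>
lemma maximal_disjoint_separable_open_family:
  fixes X :: "'a topology"
  assumes "locally_separable_space X"
  shows "\<exists>\<U>. (\<forall>U\<in>\<U>. openin X U \<and> U \<noteq> {} \<and> separable_space (subtopology X U)) \<and>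
             pairwise disjnt \<U> \<and> X closure_of \<Union>\<U> = topspace X"
proof -
  define good where "good U \<longleftrightarrow> openin X U \<and> U \<noteq> {} \<and> separable_space (subtopology X U)" for U
  have "\<exists>\<U>\<in>{\<U>. (\<forall>U\<in>\<U>. good U) \<and> pairwise disjnt \<U>}.
          \<forall>\<V>\<in>{\<U>. (\<forall>U\<in>\<U>. good U) \<and> pairwise disjnt \<U>}. \<U> \<subseteq> \<V> \<longrightarrow> \<V> = \<U>"
    by (rule Zorn_Lemma) (auto simp: chains_def intro: pairwise_chain_Union)
  then obtain \<U> where \<U>: "\<forall>U\<in>\<U>. good U" "pairwise disjnt \<U>"
    and max: "\<And>\<V>. \<lbrakk>\<forall>U\<in>\<V>. good U; pairwise disjnt \<V>; \<U> \<subseteq> \<V>\<rbrakk> \<Longrightarrow> \<V> = \<U>"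
    by auto
  have "x \<in> X closure_of \<Union>\<U>" if x: "x \<in> topspace X" for x
  proof (rule ccontr)
    assume "x \<notin> X closure_of \<Union>\<U>"
    then obtain T where T: "openin X T" "x \<in> T" "T \<inter> \<Union>\<U> = {}"
      using x by (auto simp: in_closure_of)
    obtain W where W: "openin X W" "x \<in> W" "separable_space (subtopology X W)"
      using assms x by (auto simp: locally_separable_space_def)
    have "openin (subtopology X W) (W \<inter> T)"
      using T(1) by (simp add: openin_subtopology_Int2)
    then have "separable_space (subtopology X (W \<inter> T))"
      using separable_space_open_subset[OF W(3), of "W \<inter> T"] by (simp add: subtopology_subtopology)
    then have "good (W \<inter> T)"
      using T W by (auto simp: good_def)
    moreover have "\<forall>U\<in>\<U>. disjnt (W \<inter> T) U"
      using T(3) by (auto simp: disjnt_def)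
    ultimately have "insert (W \<inter> T) \<U> = \<U>"
      using \<U> by (intro max) (auto simp: pairwise_insert disjnt_sym)
    then show False
      using T W by blast
  qed
  then have "X closure_of \<Union>\<U> = topspace X"
    by (simp add: closure_of_subset_topspace subset_antisym subsetI)
  then show ?thesis
    using \<U> unfolding good_def by blast
qed

text \<open>
  The union of countable dense subsets of the members of \<open>\<U>\<close> is dense in \<open>X\<close>.  A finite \<open>\<U>\<close> would
  make it countable; for infinite \<open>\<U>\<close> it has at most \<open>|\<U>|\<close> elements.
\<close>
lemma density_ordLeq_disjoint_family:
  assumes X: "\<not> separable_space X"
    and \<U>: "\<And>U. U \<in> \<U> \<Longrightarrow> openin X U \<and> separable_space (subtopology X U)"
    and dense: "X closure_of \<Union>\<U> = topspace X"
  shows "infinite \<U>" "\<exists>D. dense_in X D \<and> |D| \<le>o |\<U>|"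
proof -
  have "\<forall>U\<in>\<U>. \<exists>C. countable C \<and> C \<subseteq> U \<and> U \<subseteq> X closure_of C"
  proof
    fix U assume "U \<in> \<U>"
    then show "\<exists>C. countable C \<and> C \<subseteq> U \<and> U \<subseteq> X closure_of C"
      using \<U>[of U] separable_subtopology_iff[of U X] openin_subset[of X U] by simp
  qed
  from bchoice[OF this] obtain C
    where C': "\<forall>U\<in>\<U>. countable (C U) \<and> C U \<subseteq> U \<and> U \<subseteq> X closure_of C U" ..
  then have C: "countable (C U)" "C U \<subseteq> U" "U \<subseteq> X closure_of C U" if "U \<in> \<U>" for U
    using that by simp_all
  let ?D = "\<Union>U\<in>\<U>. C U"
  have "\<Union>\<U> \<subseteq> X closure_of ?D"
  proof (rule Union_least)
    fix U assume "U \<in> \<U>"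
    then show "U \<subseteq> X closure_of ?D"
      using C closure_of_mono[of "C U" ?D X] by blast
  qed
  then have "X closure_of \<Union>\<U> \<subseteq> X closure_of ?D"
    by (simp add: closure_of_minimal)
  moreover have "?D \<subseteq> topspace X"
    using C \<U> openin_subset by blast
  ultimately have D: "dense_in X ?D"
    using dense by (simp add: dense_in_def closure_of_subset_topspace subset_antisym)
  show inf: "infinite \<U>"
  proof
    assume "finite \<U>"
    then have "countable ?D"
      using C by (simp add: countable_finite)
    then show False
      using X D separable_space_iff_dense_in by blast
  qed
  have "|?D| \<le>o |\<U>|"
  proof (rule card_of_UNION_ordLeq_infinite[OF inf])
    show "|\<U>| \<le>o |\<U>|"
      by (rule card_of_mono1) simp
    show "\<forall>U\<in>\<U>. |C U| \<le>o |\<U>|"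
    proof
      fix U assume "U \<in> \<U>"
      then have "|C U| \<le>o |UNIV :: nat set|"
        using C card_of_ordLeqI[of "to_nat_on (C U)" "C U" "UNIV :: nat set"] by auto
      then show "|C U| \<le>o |\<U>|"
        using inf infinite_iff_card_of_nat ordLeq_transitive by blast
    qed
  qed
  with D show "\<exists>D. dense_in X D \<and> |D| \<le>o |\<U>|"
    by blast
qed

text \<open>
  The members of \<open>V\<close> need not form a locally finite family, so continuity comes from uniform
  convergence.  The sum vanishes off a countable union of separable sets, hence has separable support.
\<close>
lemma geometric_series_in_Cs:
  fixes X :: "'a topology" and V :: "nat \<Rightarrow> 'a set" and g :: "nat \<Rightarrow> 'a \<Rightarrow> real"
  assumes V: "\<And>n. openin X (V n) \<and> separable_space (subtopology X (V n))"
    and g: "\<And>n. continuous_map X euclidean (g n)" "\<And>n x. 0 \<le> g n x \<and> g n x \<le> 1"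
      "\<And>n x. x \<notin> V n \<Longrightarrow> g n x = 0"
  shows "(\<lambda>x. of_real (\<Sum>n. (1/2)^n * g n x) :: 'k::real_normed_field) \<in> Cs X"
proof -
  let ?r = "\<lambda>x. \<Sum>n. (1/2)^n * g n x"
  let ?f = "\<lambda>x. of_real (?r x) :: 'k"
  have sum2: "summable (\<lambda>n. (1/2 :: real)^n)"
    by (rule summable_geometric) simp
  have bound: "norm ((1/2)^n * g n x) \<le> (1/2)^n" for n x
    using g(2)[of n x] by (simp add: abs_mult mult_left_le)
  have "continuous_map X euclidean ?r"
    using bound sum2
    by (intro continuous_map_suminf[where M = "\<lambda>n. (1/2)^n"] continuous_map_real_mult g) auto
  then have "continuous_map X euclidean (of_real \<circ> ?r :: 'a \<Rightarrow> 'k)"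
    by (rule continuous_map_compose) (auto intro: continuous_intros)
  then have cont: "continuous_map X euclidean ?f"
    by (simp add: o_def)
  have "norm (?f x) \<le> (\<Sum>n. (1/2)^n)" for x
  proof -
    have "norm (?r x) \<le> (\<Sum>n. (1/2)^n)"
      by (rule norm_suminf_le[OF bound sum2])
    then show ?thesis
      by simp
  qed
  then have "bounded (?f ` topspace X)"
    by (intro boundedI[of _ "\<Sum>n. (1/2)^n"]) blast
  moreover have zero: "?f x = 0" if "\<And>n. x \<notin> V n" for x
    using that g(3) by simp
  moreover have "x \<notin> V n" if "x \<notin> topspace X" for x n
    using V[of n] that openin_subset by blast
  ultimately have Cb: "?f \<in> Cb X"
    using cont by (auto simp: Cb_def)
  have "\<exists>C. countable C \<and> V n \<subseteq> X closure_of C" for n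
    using V[of n] separable_subtopology_iff[of "V n" X] openin_subset by blast
  then obtain C where C: "\<And>n. countable (C n) \<and> V n \<subseteq> X closure_of C n"
    by metis
  show ?thesis
  proof (rule Cs_if_Coz_subset_closure_countable[OF Cb])
    show "countable (\<Union>n. C n)"
      using C by simp
    show "Coz X ?f \<subseteq> X closure_of (\<Union>n. C n)"
    proof
      fix x assume "x \<in> Coz X ?f"
      then obtain n where "x \<in> V n"
        using zero unfolding Coz_def by blast
      then show "x \<in> X closure_of (\<Union>n. C n)"
        using C[of n] closure_of_mono[of "C n" "\<Union>n. C n" X] by blast
    qed
  qed
qed

text \<open>
  This is the almost disjointness of the branches of the tree of finite sequences: past the last of
  the first differences, the prefixes of \<open>s\<close> lie on none of the branches of members of \<open>T\<close>.
\<close>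
lemma finitely_many_sequences_separated_by_prefix:
  fixes s :: "nat \<Rightarrow> 'b"
  assumes "finite T" "s \<notin> T"
  shows "\<exists>n. \<forall>t\<in>T. map t [0..<n] \<noteq> map s [0..<n]"
proof -
  have "\<exists>k. t k \<noteq> s k" if "t \<in> T" for t
    using assms(2) that by (metis ext)
  then obtain k where k: "\<And>t. t \<in> T \<Longrightarrow> t (k t) \<noteq> s (k t)"
    by metis
  obtain n where n: "\<And>t. t \<in> T \<Longrightarrow> k t < n"
    using finite_nat_bounded[of "k ` T"] assms(1) by auto
  have "map t [0..<n] \<noteq> map s [0..<n]" if "t \<in> T" for t
    using k[OF that] n[OF that] by (auto simp: map_eq_conv)
  then show ?thesis
    by blast
qed

text \<open>
  The lower bound.  The family consists of the functions \<open>F s\<close>, one for each sequence \<open>s\<close> in \<open>\<U>\<close>,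
  where \<open>F s\<close> is a weighted sum of bumps on the sets that code the finite prefixes of \<open>s\<close>.
\<close>
lemma independent_family_in_Cs:
  fixes X :: "'a topology"
  assumes X: "completely_regular_space X" and inf: "infinite \<U>"
    and \<U>: "\<And>U. U \<in> \<U> \<Longrightarrow> openin X U \<and> U \<noteq> {} \<and> separable_space (subtopology X U)"
    and disj: "pairwise disjnt \<U>"
  shows "\<exists>B \<subseteq> (Cs X :: ('a \<Rightarrow> 'k::real_normed_field) set).
           \<not> fun_scale.dependent B \<and> |\<U>| ^c natLeq \<le>o |B|"
proof -
  obtain c where c: "inj_on c (lists \<U>)" "c ` lists \<U> \<subseteq> \<U>"
    using list_code_exists[OF inf] by blast
  obtain p where p: "\<And>U. U \<in> \<U> \<Longrightarrow> p U \<in> U"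
    using \<U> by (metis ex_in_conv)
  have "\<exists>g :: 'a \<Rightarrow> real. continuous_map X euclidean g \<and> (\<forall>x. 0 \<le> g x \<and> g x \<le> 1) \<and>
           g (p U) = 1 \<and> (\<forall>x. x \<notin> U \<longrightarrow> g x = 0)" if "U \<in> \<U>" for U
    using bump_function_exists[OF X] \<U> p that by blast
  then obtain g :: "'a set \<Rightarrow> 'a \<Rightarrow> real" where g: "\<And>U. U \<in> \<U> \<Longrightarrow>
      continuous_map X euclidean (g U) \<and> (\<forall>x. 0 \<le> g U x \<and> g U x \<le> 1) \<and>
      g U (p U) = 1 \<and> (\<forall>x. x \<notin> U \<longrightarrow> g U x = 0)"
    by metis
  have g_other: "g U (p V) = 0" if "U \<in> \<U>" "V \<in> \<U>" "U \<noteq> V" for U V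
    using that g p disj by (auto simp: pairwise_def disjnt_iff)
  \<comment> \<open>\<open>V s n\<close> is the node at level \<open>n\<close> of the branch of \<open>s\<close>.\<close>
  define V where "V s n = c (map s [0..<n])" for s :: "nat \<Rightarrow> 'a set" and n
  let ?S = "{s :: nat \<Rightarrow> 'a set. range s \<subseteq> \<U>}"
  have pre: "map s [0..<n] \<in> lists \<U>" if "s \<in> ?S" for s :: "nat \<Rightarrow> 'a set" and n
    using that by (auto simp: image_subset_iff)
  have V: "V s n \<in> \<U>" if "s \<in> ?S" for s n
    using c(2) pre[OF that] by (auto simp: V_def)
  have V_eq: "map s [0..<m] = map t [0..<n]" if "V s m = V t n" "s \<in> ?S" "t \<in> ?S" for s t m n
    using that inj_onD[OF c(1) _ pre pre] by (simp add: V_def)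
  define r where "r s x = (\<Sum>n. (1/2)^n * g (V s n) x)" for s x
  define F :: "(nat \<Rightarrow> 'a set) \<Rightarrow> 'a \<Rightarrow> 'k" where "F s = (\<lambda>x. of_real (r s x))" for s
  have F_Cs: "F s \<in> Cs X" if "s \<in> ?S" for s
    unfolding F_def r_def using \<U> g V[OF that]
    by (intro geometric_series_in_Cs[of X "V s" "\<lambda>n. g (V s n)"]) auto
  have sep: "\<exists>x. F s x \<noteq> 0 \<and> (\<forall>t\<in>T. F t x = 0)" if T: "finite T" "T \<subseteq> ?S" "s \<in> ?S - T" for T s
  proof -
    have s: "s \<in> ?S" "s \<notin> T"
      using T(3) by auto
    obtain n where n: "\<forall>t\<in>T. map t [0..<n] \<noteq> map s [0..<n]"
      using finitely_many_sequences_separated_by_prefix[OF T(1) s(2)] by blast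
    \<comment> \<open>The peak of the bump at a node of \<open>s\<close> that lies on no branch of a member of \<open>T\<close>.\<close>
    let ?x = "p (V s n)"
    have gs: "g (V s m) ?x = (if m = n then 1 else 0)" for m
    proof (cases "m = n")
      case False
      then have "V s m \<noteq> V s n"
        using arg_cong[OF V_eq[OF _ s(1) s(1)], of m n length] by auto
      then show ?thesis
        using False g_other V s(1) by simp
    qed (use g V s(1) in auto)
    have "r s ?x = (\<Sum>m. if m = n then (1/2)^m else 0)"
      unfolding r_def gs by (rule arg_cong[where f = suminf]) auto
    also have "\<dots> = (1/2)^n"
      using suminf_finite[of "{n}" "\<lambda>m. if m = n then (1/2 :: real)^m else 0"] by simp
    finally have "F s ?x \<noteq> 0"
      by (simp add: F_def)
    moreover have "F t ?x = 0" if t: "t \<in> T" for t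
    proof -
      have tS: "t \<in> ?S"
        using T(2) t by blast
      have "V t m \<noteq> V s n" for m
      proof
        assume "V t m = V s n"
        then have eq: "map t [0..<m] = map s [0..<n]"
          using V_eq[OF _ tS s(1)] by simp
        from arg_cong[OF this, of length] have "m = n"
          by simp
        with eq have "map t [0..<n] = map s [0..<n]"
          by (simp only:)
        with n t show False
          by (simp only:)
      qed
      then have "g (V t m) ?x = 0" for m
        by (intro g_other V tS s(1))
      then show ?thesis
        by (simp add: F_def r_def)
    qed
    ultimately show ?thesis
      by blast
  qed
  have "inj_on F ?S" and indep: "\<not> fun_scale.dependent (F ` ?S)"
    using independent_if_separating_points[of ?S F] sep by blast+
  then have "|?S| \<le>o |F ` ?S|"
    by (intro card_of_ordLeqI[of F]) auto
  moreover have "F ` ?S \<subseteq> Cs X"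
    using F_Cs by blast
  ultimately show ?thesis
    using indep unfolding card_of_cexp_natLeq by blast
qed

text \<open>
  Both bounds combined, for a class of scalar fields that contains the real and the complex numbers.
\<close>
lemma hamel_dim_Cs:
  fixes X :: "'a topology"
  assumes met: "metrizable_space X" and loc: "locally_separable_space X"
    and nonsep: "\<not> separable_space X"
  shows "hamel_dim fun_scale (Cs X :: ('a \<Rightarrow> 'k::{real_normed_field, second_countable_topology}) set)
           =o top_density X ^c natLeq"
proof -
  let ?C = "Cs X :: ('a \<Rightarrow> 'k) set"
  obtain D where D: "dense_in X D" "\<And>D'. dense_in X D' \<Longrightarrow> |D| \<le>o |D'|" "top_density X = |D|"
    using top_density_attained[of X] by blast
  have "infinite D"
    using nonsep D(1) separable_space_iff_dense_in countable_finite by blast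
  then have upper: "hamel_dim fun_scale ?C \<le>o |D| ^c natLeq"
    using fun_scale.hamel_dim_ordLeq[OF subspace_Cs] card_of_Cs_ordLeq[OF met D(1)]
      ordLeq_transitive by blast
  obtain \<U> where \<U>: "\<forall>U\<in>\<U>. openin X U \<and> U \<noteq> {} \<and> separable_space (subtopology X U)"
      "pairwise disjnt \<U>" "X closure_of \<Union>\<U> = topspace X"
    using maximal_disjoint_separable_open_family[OF loc] by blast
  have inf: "infinite \<U>" and "\<exists>D'. dense_in X D' \<and> |D'| \<le>o |\<U>|"
    using density_ordLeq_disjoint_family[OF nonsep, of \<U>] \<U> by auto
  then have "|D| \<le>o |\<U>|"
    using D(2) ordLeq_transitive by blast
  then have "|D| ^c natLeq \<le>o |\<U>| ^c natLeq"
    by (rule cexp_mono1) (rule natLeq_Card_order)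
  also obtain B where B: "B \<subseteq> ?C" "\<not> fun_scale.dependent B" "|\<U>| ^c natLeq \<le>o |B|"
    using independent_family_in_Cs[OF metrizable_imp_completely_regular_space[OF met] inf] \<U>(1,2)
    by blast
  note B(3)
  also have "|B| \<le>o hamel_dim fun_scale ?C"
    by (rule fun_scale.independent_ordLeq_hamel_dim[OF subspace_Cs B(1,2)])
  finally have "|D| ^c natLeq \<le>o hamel_dim fun_scale ?C" .
  with upper show ?thesis
    by (simp add: D(3) ordIso_iff_ordLeq)
qed

theorem theorem3p1:
  fixes X :: "'a topology"
  assumes "metrizable_space X"
    and "locally_separable_space X"
    and "\<not> separable_space X"
  shows "hamel_dim fun_scale (Cs X :: ('a \<Rightarrow> real) set) =o top_density X ^c natLeq \<and>
         hamel_dim fun_scale (Cs X :: ('a \<Rightarrow> complex) set) =o top_density X ^c natLeq"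
  by (rule conjI[OF hamel_dim_Cs[OF assms] hamel_dim_Cs[OF assms]])

end
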